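(* There exists an ordering on the two-sided stationary generalized Pascal-Bratteli diagram $\widetilde B$ that has no infinite minimal paths and no infinite maximal paths.
   Context: $\widetilde B$ is the generalized Bratteli diagram with levels $V_k$, $k\ge0$, each a copy of $\mathbb Z$, and with exactly one edge from vertex $n\in V_k$ to vertex $n\in V_{k+1}$ and exactly one edge from vertex $n\in V_k$ to vertex $n+1\in V_{k+1}$, and no other edges, for all $k\ge 0$, $n\in\mathbb Z$ (so its incidence matrix is the $\mathbb Z\times\mathbb Z$ matrix with $1$ on the main diagonal and on the first subdiagonal and $0$ elsewhere). Thus every vertex $v$ of level at least $1$ has exactly two incoming edges. An ordering on $\widetilde B$ is a choice of a linear order on the set $r^{-1}(v)$ of edges arriving at $v$, for every vertex $v$ of level at least $1$. An infinite path $(e_0,e_1,\dots)$ starting at a vertex of $V_0$, with $e_k$ joining $V_k$ to $V_{k+1}$, is minimal (respectively maximal) if each $e_k$ is minimal (respectively maximal) in $r^{-1}(r(e_k))$, where $r(e_k)\in V_{k+1}$ is the endpoint of $e_k$. *)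

theory Defs
  imports Main
begin

text \<open>Vertices and edges of the various levels live in common types; \<open>edges_of B k\<close> is the set of
  edges joining \<open>levels B k\<close> to \<open>levels B (Suc k)\<close>.\<close>

record ('v, 'e) bratteli =
  levels :: "nat \<Rightarrow> 'v set"
  edges_of :: "nat \<Rightarrow> 'e set"
  source :: "'e \<Rightarrow> 'v"
  range_of :: "'e \<Rightarrow> 'v"

text \<open>The set \<open>r\<^sup>-\<^sup>1(v)\<close>.\<close>

definition incoming :: "('v, 'e) bratteli \<Rightarrow> 'v \<Rightarrow> 'e set" where
  "incoming B v = {e \<in> (\<Union>k. edges_of B k). range_of B e = v}"

text \<open>An ordering assigns to each vertex \<open>v\<close> of positive level a reflexive linear order on
  \<open>r\<^sup>-\<^sup>1(v)\<close>; its value at other vertices is irrelevant.\<close>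

definition bratteli_ordering :: "('v, 'e) bratteli \<Rightarrow> ('v \<Rightarrow> 'e rel) \<Rightarrow> bool" where
  "bratteli_ordering B ord \<longleftrightarrow>
     (\<forall>k\<ge>1. \<forall>v\<in>levels B k. linear_order_on (incoming B v) (ord v))"

definition infinite_path :: "('v, 'e) bratteli \<Rightarrow> (nat \<Rightarrow> 'e) \<Rightarrow> bool" where
  "infinite_path B p \<longleftrightarrow>
     source B (p 0) \<in> levels B 0 \<and>
     (\<forall>k. p k \<in> edges_of B k \<and> range_of B (p k) = source B (p (Suc k)))"

definition minimal_edge :: "('v, 'e) bratteli \<Rightarrow> ('v \<Rightarrow> 'e rel) \<Rightarrow> 'e \<Rightarrow> bool" where
  "minimal_edge B ord e \<longleftrightarrow>
     \<not> (\<exists>f\<in>incoming B (range_of B e). f \<noteq> e \<and> (f, e) \<in> ord (range_of B e))"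

definition maximal_edge :: "('v, 'e) bratteli \<Rightarrow> ('v \<Rightarrow> 'e rel) \<Rightarrow> 'e \<Rightarrow> bool" where
  "maximal_edge B ord e \<longleftrightarrow>
     \<not> (\<exists>f\<in>incoming B (range_of B e). f \<noteq> e \<and> (e, f) \<in> ord (range_of B e))"

definition infinite_minimal_path :: "('v, 'e) bratteli \<Rightarrow> ('v \<Rightarrow> 'e rel) \<Rightarrow> (nat \<Rightarrow> 'e) \<Rightarrow> bool" where
  "infinite_minimal_path B ord p \<longleftrightarrow> infinite_path B p \<and> (\<forall>k. minimal_edge B ord (p k))"

definition infinite_maximal_path :: "('v, 'e) bratteli \<Rightarrow> ('v \<Rightarrow> 'e rel) \<Rightarrow> (nat \<Rightarrow> 'e) \<Rightarrow> bool" where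
  "infinite_maximal_path B ord p \<longleftrightarrow> infinite_path B p \<and> (\<forall>k. maximal_edge B ord (p k))"

text \<open>The vertex \<open>n\<close> of level \<open>k\<close> is the pair \<open>(k, n)\<close>. There are no multiple edges, so an edge is
  the pair of its source and its range.\<close>

definition pascal_two_sided :: "(nat \<times> int, (nat \<times> int) \<times> (nat \<times> int)) bratteli" where
  "pascal_two_sided =
     \<lparr>levels = (\<lambda>k. {k} \<times> UNIV),
      edges_of = (\<lambda>k. {((k, n), (Suc k, m)) | n m. m = n \<or> m = n + 1}),
      source = fst,
      range_of = snd\<rparr>"

text \<open>Rows of the incidence matrix are indexed by ranges and columns by sources: there are ones on
  the main diagonal and the first subdiagonal, zeros elsewhere.\<close>

lemma pascal_two_sided_incidence:
  "card {e \<in> edges_of pascal_two_sided k.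
           source pascal_two_sided e = (k, n) \<and> range_of pascal_two_sided e = (Suc k, m)}
   = (if m = n \<or> m = n + 1 then 1 else 0)"
proof -
  have "{e \<in> edges_of pascal_two_sided k.
           source pascal_two_sided e = (k, n) \<and> range_of pascal_two_sided e = (Suc k, m)}
        = (if m = n \<or> m = n + 1 then {((k, n), (Suc k, m))} else {})"
    by (auto simp: pascal_two_sided_def)
  then show ?thesis
    by simp
qed

lemma incoming_pascal_two_sided:
  "incoming pascal_two_sided (Suc k, m) = {((k, m), (Suc k, m)), ((k, m - 1), (Suc k, m))}"
  by (auto simp: incoming_def pascal_two_sided_def)

end

theory Submission
  imports Defs
begin

text \<open>
  An ordering amounts to a choice, at every vertex of positive level, of which of its two incoming
  edges is the minimal one; the other one is then maximal. Measure the position of the vertex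
  \<open>(k, n)\<close> by its offset \<open>2 * n - k\<close> from the line of slope one half. Every edge changes the offset
  by exactly \<open>1\<close>, and each vertex has one distinguished incoming edge, called inward below, along
  which the absolute value of the offset drops by \<open>1\<close>. Hence a path with inward edges only has at most
  as many edges as its initial absolute offset.

  If the inward edge were minimal everywhere, no infinite minimal path would exist, but infinite
  maximal paths would. So the two roles alternate in time: the inward edge is minimal at the levels
  of a set \<open>M\<close> and maximal at the other levels. A path whose initial absolute offset is less than
  \<open>N\<close> has absolute offset less than \<open>s + N\<close> at level \<open>s\<close>, so its edges from level \<open>s\<close> to level
  \<open>2 * s + N\<close> cannot all be inward. It therefore suffices that both \<open>M\<close> and its complement
  contain, for every \<open>N\<close>, a block of levels of this kind. Blocks whose end points form a geometric
  progression of ratio \<open>4\<close>, taken alternately into \<open>M\<close> and out of \<open>M\<close>, achieve this.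
\<close>

text \<open>A path can move away from the centre line by \<open>s\<close> before level \<open>s\<close>, so a block that is
  to stop every path must exceed its own starting level in length by an arbitrary amount.\<close>

definition has_long_blocks :: "nat set \<Rightarrow> bool" where
  "has_long_blocks K \<longleftrightarrow> (\<forall>N. \<exists>s. {s<..2 * s + N} \<subseteq> K)"

text \<open>The growth before the block is at most \<open>s\<close>, and the block is longer than that by more than
  the initial value.\<close>

lemma no_sequence_decreasing_on_long_blocks:
  fixes a :: "nat \<Rightarrow> int"
  assumes nonneg: "\<And>k. 0 \<le> a k"
    and growth: "\<And>k. a (Suc k) \<le> a k + 1"
    and decrease: "\<And>k. Suc k \<in> K \<Longrightarrow> a (Suc k) \<le> a k - 1"
    and "has_long_blocks K"
  shows False
proof -
  obtain s where s: "{s<..2 * s + nat (a 0 + 1)} \<subseteq> K"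
    using assms(4) unfolding has_long_blocks_def by blast
  have upto: "a k \<le> a 0 + int k" for k
  proof (induction k)
    case (Suc k)
    then show ?case using growth[of k] by simp
  qed simp
  have "j \<le> s + nat (a 0 + 1) \<Longrightarrow> a (s + j) \<le> a s - int j" for j
  proof (induction j)
    case (Suc j)
    from Suc.prems have "Suc (s + j) \<in> {s<..2 * s + nat (a 0 + 1)}" by simp
    with s have "Suc (s + j) \<in> K" by blast
    then show ?case using decrease[of "s + j"] Suc by simp
  qed simp
  from this[of "s + nat (a 0 + 1)"] upto[of s] nonneg[of 0] nonneg[of "s + (s + nat (a 0 + 1))"]
  show False by simp
qed

definition alternating_levels :: "nat set" where
  "alternating_levels = (\<Union>i. {16 ^ i..<4 * 16 ^ i})"

lemma alternating_levels_has_long_blocks: "has_long_blocks alternating_levels"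
  unfolding has_long_blocks_def
proof
  fix N :: nat
  have "N < 16 ^ N" by (rule less_exp[THEN less_le_trans]) (simp add: power_mono)
  then have "{16 ^ N<..2 * 16 ^ N + N} \<subseteq> {16 ^ N..<4 * 16 ^ N}" by auto
  then show "\<exists>s. {s<..2 * s + N} \<subseteq> alternating_levels"
    unfolding alternating_levels_def by blast
qed

lemma alternating_levels_gap:
  assumes "4 * 16 ^ i \<le> k" "k < 16 * 16 ^ i"
  shows "k \<notin> alternating_levels"
proof
  assume "k \<in> alternating_levels"
  then obtain j where j: "16 ^ j \<le> k" "k < 4 * 16 ^ j"
    by (auto simp: alternating_levels_def)
  show False
  proof (cases "j \<le> i")
    case True
    then have "(16::nat) ^ j \<le> 16 ^ i" by (simp add: power_increasing)
    with j assms show False by linarith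
  next
    case False
    then have "(16::nat) ^ Suc i \<le> 16 ^ j" by (intro power_increasing) auto
    with j assms show False by simp
  qed
qed

lemma compl_alternating_levels_has_long_blocks: "has_long_blocks (- alternating_levels)"
  unfolding has_long_blocks_def
proof
  fix N :: nat
  have N: "N < 16 ^ N" by (rule less_exp[THEN less_le_trans]) (simp add: power_mono)
  have "k \<notin> alternating_levels" if "k \<in> {4 * 16 ^ N<..2 * (4 * 16 ^ N) + N}" for k
  proof (rule alternating_levels_gap)
    show "4 * 16 ^ N \<le> k" using that by simp
    have "k \<le> 8 * 16 ^ N + N" using that by simp
    then show "k < 16 * 16 ^ N" using N by linarith
  qed
  then show "\<exists>s. {s<..2 * s + N} \<subseteq> - alternating_levels"
    by blast
qed

fun offset :: "nat \<times> int \<Rightarrow> int" where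
  "offset (k, n) = 2 * n - int k"

text \<open>Both edges into a vertex of offset \<open>0\<close> decrease the absolute offset, so inwardness is not
  defined by that property: the non-strict inequality breaks the tie, so that each vertex of
  positive level has exactly one inward incoming edge.\<close>

fun inward :: "(nat \<times> int) \<times> (nat \<times> int) \<Rightarrow> bool" where
  "inward ((k, n), v) \<longleftrightarrow> (snd v = n + 1 \<longleftrightarrow> offset v \<le> 0)"

lemma abs_offset_step:
  assumes "(u, v) \<in> edges_of pascal_two_sided k"
  shows "\<bar>offset v\<bar> \<le> \<bar>offset u\<bar> + 1"
  using assms by (auto simp: pascal_two_sided_def)

text \<open>A diagonal edge raises the offset by \<open>1\<close> and a vertical edge lowers it by \<open>1\<close>. An inward
  diagonal edge ends at an offset \<open>\<le> 0\<close>, an inward vertical edge at an offset \<open>> 0\<close>, so in either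
  case the offset moves towards \<open>0\<close> without crossing it.\<close>

lemma abs_offset_inward:
  assumes "(u, v) \<in> edges_of pascal_two_sided k" "inward (u, v)"
  shows "\<bar>offset v\<bar> = \<bar>offset u\<bar> - 1"
  using assms by (auto simp: pascal_two_sided_def)

lemma no_infinite_path_inward_on_long_blocks:
  assumes path: "infinite_path pascal_two_sided p"
    and inw: "\<And>k. Suc k \<in> K \<Longrightarrow> inward (p k)"
    and "has_long_blocks K"
  shows False
proof -
  have edge: "(fst (p k), fst (p (Suc k))) \<in> edges_of pascal_two_sided k"
    and eq: "p k = (fst (p k), fst (p (Suc k)))" for k
  proof -
    have "p k \<in> edges_of pascal_two_sided k" and "snd (p k) = fst (p (Suc k))"
      using path by (auto simp: infinite_path_def pascal_two_sided_def)
    then show "p k = (fst (p k), fst (p (Suc k)))"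
      and "(fst (p k), fst (p (Suc k))) \<in> edges_of pascal_two_sided k"
      by (metis prod.collapse)+
  qed
  show False
  proof (rule no_sequence_decreasing_on_long_blocks[of "\<lambda>k. \<bar>offset (fst (p k))\<bar>"])
    show "\<bar>offset (fst (p (Suc k)))\<bar> \<le> \<bar>offset (fst (p k))\<bar> + 1" for k
      by (rule abs_offset_step[OF edge])
    show "\<bar>offset (fst (p (Suc k)))\<bar> \<le> \<bar>offset (fst (p k))\<bar> - 1" if "Suc k \<in> K" for k
      using abs_offset_inward[OF edge] inw[OF that] eq[of k] by simp
  qed (use assms in auto)
qed

text \<open>Of the two edges into \<open>v\<close>, the inward one comes first if the level of \<open>v\<close> is in \<open>M\<close>, and
  last otherwise.\<close>

definition switching_order ::
    "nat set \<Rightarrow> nat \<times> int \<Rightarrow> ((nat \<times> int) \<times> (nat \<times> int)) rel" where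
  "switching_order M v = {(e, f). e \<in> incoming pascal_two_sided v \<and> f \<in> incoming pascal_two_sided v \<and>
     (e = f \<or> (inward e \<longleftrightarrow> fst v \<in> M))}"

lemma bratteli_ordering_switching_order:
  "bratteli_ordering pascal_two_sided (switching_order M)"
  unfolding bratteli_ordering_def
proof (intro allI impI ballI)
  fix k :: nat and v
  assume "1 \<le> k" "v \<in> levels pascal_two_sided k"
  then obtain l m where v: "v = (Suc l, m)"
    by (cases k) (auto simp: pascal_two_sided_def)
  show "linear_order_on (incoming pascal_two_sided v) (switching_order M v)"
    unfolding v linear_order_on_def partial_order_on_def preorder_on_def refl_on_def trans_def
      antisym_def total_on_def switching_order_def incoming_pascal_two_sided
    by auto
qed

lemma edge_competitor:
  assumes "e \<in> edges_of pascal_two_sided k"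
  obtains f where "f \<in> incoming pascal_two_sided (snd e)" "e \<in> incoming pascal_two_sided (snd e)"
    "f \<noteq> e" "inward f \<longleftrightarrow> \<not> inward e" "fst (snd e) = Suc k"
proof -
  obtain n m where e: "e = ((k, n), (Suc k, m))" and nm: "m = n \<or> m = n + 1"
    using assms by (auto simp: pascal_two_sided_def)
  from nm show ?thesis
  proof
    assume "m = n"
    then show ?thesis
      by (intro that[of "((k, m - 1), (Suc k, m))"]) (auto simp: e incoming_pascal_two_sided)
  next
    assume "m = n + 1"
    then show ?thesis
      by (intro that[of "((k, m), (Suc k, m))"]) (auto simp: e incoming_pascal_two_sided)
  qed
qed

text \<open>If the edge were not inward, the other edge into the same vertex would be inward, hence
  strictly smaller. In the dual lemma that follows, it would be strictly larger.\<close>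

lemma minimal_edge_switching_order_inward:
  assumes "e \<in> edges_of pascal_two_sided k" "minimal_edge pascal_two_sided (switching_order M) e"
    and "Suc k \<in> M"
  shows "inward e"
proof -
  have r: "range_of pascal_two_sided = snd" by (simp add: pascal_two_sided_def)
  obtain f where "f \<in> incoming pascal_two_sided (snd e)" "e \<in> incoming pascal_two_sided (snd e)"
    "f \<noteq> e" "inward f \<longleftrightarrow> \<not> inward e" "fst (snd e) = Suc k"
    using edge_competitor[OF assms(1)] .
  with assms(2,3) show ?thesis
    by (auto simp: minimal_edge_def switching_order_def r)
qed

lemma maximal_edge_switching_order_inward:
  assumes "e \<in> edges_of pascal_two_sided k" "maximal_edge pascal_two_sided (switching_order M) e"
    and "Suc k \<notin> M"
  shows "inward e"
proof -
  have r: "range_of pascal_two_sided = snd" by (simp add: pascal_two_sided_def)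
  obtain f where "f \<in> incoming pascal_two_sided (snd e)" "e \<in> incoming pascal_two_sided (snd e)"
    "f \<noteq> e" "inward f \<longleftrightarrow> \<not> inward e" "fst (snd e) = Suc k"
    using edge_competitor[OF assms(1)] .
  with assms(2,3) show ?thesis
    by (auto simp: maximal_edge_def switching_order_def r)
qed

lemma no_infinite_minimal_path_switching_order:
  assumes "has_long_blocks M"
  shows "\<not> infinite_minimal_path pascal_two_sided (switching_order M) p"
proof
  assume "infinite_minimal_path pascal_two_sided (switching_order M) p"
  then have path: "infinite_path pascal_two_sided p"
    and min: "minimal_edge pascal_two_sided (switching_order M) (p k)" for k
    by (auto simp: infinite_minimal_path_def)
  have edge: "p k \<in> edges_of pascal_two_sided k" for k
    using path by (simp add: infinite_path_def)
  from path minimal_edge_switching_order_inward[OF edge min] assms show False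
    by (rule no_infinite_path_inward_on_long_blocks)
qed

lemma no_infinite_maximal_path_switching_order:
  assumes "has_long_blocks (- M)"
  shows "\<not> infinite_maximal_path pascal_two_sided (switching_order M) p"
proof
  assume "infinite_maximal_path pascal_two_sided (switching_order M) p"
  then have path: "infinite_path pascal_two_sided p"
    and max: "maximal_edge pascal_two_sided (switching_order M) (p k)" for k
    by (auto simp: infinite_maximal_path_def)
  have edge: "p k \<in> edges_of pascal_two_sided k" for k
    using path by (simp add: infinite_path_def)
  have "inward (p k)" if "Suc k \<in> - M" for k
    using maximal_edge_switching_order_inward[OF edge max] that by simp
  from path this assms show False
    by (rule no_infinite_path_inward_on_long_blocks)
qed

theorem proposition5p6:
  "\<exists>ord. bratteli_ordering pascal_two_sided ord \<and>
     \<not> (\<exists>p. infinite_minimal_path pascal_two_sided ord p) \<and>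
     \<not> (\<exists>p. infinite_maximal_path pascal_two_sided ord p)"
  using bratteli_ordering_switching_order[of alternating_levels]
    no_infinite_minimal_path_switching_order[OF alternating_levels_has_long_blocks]
    no_infinite_maximal_path_switching_order[OF compl_alternating_levels_has_long_blocks]
  by blast

end
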